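(* Let $I=[0,1]$ with the Euclidean metric. There are a continuous map $f\colon I\to I$ with zero topological entropy (in fact, of type $2$ for Sharkovsky's order), a point $x_0\in I$ with finite $\omega_f(x_0)$, an integer $m\in\mathbb{N}$, and $\varepsilon>0$ such that $$\underline{c}_m(x_0,\varepsilon)<\overline{c}_m(x_0,\varepsilon).$$
   Context: $\mathbb{N}=\{1,2,\dots\}$, and $\varrho(x,y)=|x-y|$. For $m\in\mathbb{N}$, Bowen's metric is $\varrho_m(x,y)=\max\{\varrho(f^i(x),f^i(y)):0\le i<m\}$. For $x\in I$, $n\in\mathbb{N}$, $\varepsilon>0$, the correlation sum is $$C_m(x,n,\varepsilon)=\frac1{n^2}\#\{(i,j):0\le i,j<n,\ \varrho_m(f^i(x),f^j(x))\le\varepsilon\},$$ and $\underline{c}_m(x,\varepsilon)=\liminf_{n\to\infty}C_m(x,n,\varepsilon)$, $\overline{c}_m(x,\varepsilon)=\limsup_{n\to\infty}C_m(x,n,\varepsilon)$. $\omega_f(x)$ is the set of all limit points of the trajectory $(f^n(x))_{n\ge0}$. A continuous interval map is of type $2$ for Sharkovsky's order if the set of (least) periods of its periodic points is exactly $\{1,2\}$. *)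

theory Defs
  imports "HOL-Analysis.Analysis"
begin

text \<open>A self-map of a metric subspace \<open>X\<close> is a function \<open>f :: 'a \<Rightarrow> 'a\<close> with
  \<open>f ` X \<subseteq> X\<close>; its values outside \<open>X\<close> are irrelevant.\<close>

text \<open>Only meaningful for \<open>m \<ge> 1\<close> (for \<open>m = 0\<close> the maximum is taken over the empty set).\<close>

definition bowen_dist :: "('a::metric_space \<Rightarrow> 'a) \<Rightarrow> nat \<Rightarrow> 'a \<Rightarrow> 'a \<Rightarrow> real" where
  "bowen_dist f m x y = (MAX i\<in>{..<m}. dist ((f ^^ i) x) ((f ^^ i) y))"

definition corr_sum :: "('a::metric_space \<Rightarrow> 'a) \<Rightarrow> nat \<Rightarrow> 'a \<Rightarrow> nat \<Rightarrow> real \<Rightarrow> real" where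
  "corr_sum f m x n \<epsilon> =
     real (card {(i, j). i < n \<and> j < n \<and> bowen_dist f m ((f ^^ i) x) ((f ^^ j) x) \<le> \<epsilon>})
       / (real n)\<^sup>2"

definition lower_corr :: "('a::metric_space \<Rightarrow> 'a) \<Rightarrow> nat \<Rightarrow> 'a \<Rightarrow> real \<Rightarrow> ereal" where
  "lower_corr f m x \<epsilon> = liminf (\<lambda>n. ereal (corr_sum f m x n \<epsilon>))"

definition upper_corr :: "('a::metric_space \<Rightarrow> 'a) \<Rightarrow> nat \<Rightarrow> 'a \<Rightarrow> real \<Rightarrow> ereal" where
  "upper_corr f m x \<epsilon> = limsup (\<lambda>n. ereal (corr_sum f m x n \<epsilon>))"

text \<open>Limit points of the trajectory as a sequence, i.e. limits of subsequences (a value that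
  is attained infinitely often counts as a limit point).\<close>

definition omega_limit :: "('a::topological_space \<Rightarrow> 'a) \<Rightarrow> 'a \<Rightarrow> 'a set" where
  "omega_limit f x =
     {y. \<exists>r :: nat \<Rightarrow> nat. strict_mono r \<and> (\<lambda>k. (f ^^ r k) x) \<longlonglongrightarrow> y}"

definition least_period :: "('a \<Rightarrow> 'a) \<Rightarrow> 'a \<Rightarrow> nat \<Rightarrow> bool" where
  "least_period f x p \<longleftrightarrow>
     0 < p \<and> (f ^^ p) x = x \<and> (\<forall>k. 0 < k \<and> k < p \<longrightarrow> (f ^^ k) x \<noteq> x)"

definition periods :: "'a set \<Rightarrow> ('a \<Rightarrow> 'a) \<Rightarrow> nat set" where
  "periods X f = {p. \<exists>x\<in>X. least_period f x p}"

text \<open>Topological entropy in Bowen's form. \<open>spanning_number X f n \<epsilon>\<close> is the least cardinality of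
  an \<open>(n, \<epsilon>)\<close>-spanning subset of \<open>X\<close>; finite spanning sets exist for \<open>n \<ge> 1\<close> and \<open>\<epsilon> > 0\<close> when
  \<open>X\<close> is compact and \<open>f\<close> is a continuous self-map of \<open>X\<close>. The exponential growth rate is monotone
  in \<open>\<epsilon>\<close>, so its limit as \<open>\<epsilon>\<close> tends to 0 from above is the supremum over \<open>\<epsilon> > 0\<close>.\<close>

definition spanning_number :: "'a::metric_space set \<Rightarrow> ('a \<Rightarrow> 'a) \<Rightarrow> nat \<Rightarrow> real \<Rightarrow> nat" where
  "spanning_number X f n \<epsilon> =
     (LEAST k. \<exists>E. finite E \<and> E \<subseteq> X \<and> card E = k \<and> (\<forall>x\<in>X. \<exists>y\<in>E. bowen_dist f n x y \<le> \<epsilon>))"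

definition top_entropy :: "'a::metric_space set \<Rightarrow> ('a \<Rightarrow> 'a) \<Rightarrow> ereal" where
  "top_entropy X f =
     (SUP \<epsilon>\<in>{0<..}. limsup (\<lambda>n. ereal (ln (real (spanning_number X f n \<epsilon>)) / real n)))"

end

theory Submission
  imports Defs "HOL-Library.Log_Nat" "HOL-Probability.Characteristic_Functions"
begin

text \<open>
  The map interchanges \<open>[0, 1/3]\<close> and \<open>[2/3, 1]\<close>, increasingly on both, and decreases in between. A
  periodic orbit therefore either stays in the middle or in the union of the two outer intervals;
  in both cases \<open>f \<circ> f\<close> is increasing along it, so the period divides 2. Points which leave the
  middle at the same time on the same side are ordered monotonically by every iterate, up to a
  common sign. Hence, for a grid of mesh \<open>1/N\<close>, the grid itineraries of length \<open>n\<close> of such points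
  are determined by a signed sum of \<open>n\<close> grid indices, and there are only \<open>O(n\<^sup>2)\<close> itineraries
  altogether; so the entropy is 0.

  On the outer intervals the map can be chosen such that the orbit of a point is
  \<open>s\<^sub>0, 2/3 + t\<^sub>0, s\<^sub>1, 2/3 + t\<^sub>1, \<dots>\<close> for arbitrary sequences \<open>s\<close> and \<open>t\<close> strictly decreasing to 0.
  It converges to the cycle \<open>{0, 2/3}\<close>, and for \<open>\<epsilon> = 2/3\<close> the pair \<open>(s\<^sub>k, 2/3 + t\<^sub>l)\<close> counts for the
  correlation sum iff \<open>t\<^sub>l \<le> s\<^sub>k\<close>. Interleaving \<open>s\<close> and \<open>t\<close> in geometrically growing blocks makes the
  proportion of such pairs oscillate.
\<close>

section \<open>Spanning numbers from finite labellings\<close>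

text \<open>One representative per label forms a spanning set, whence the upper bound. The least
  cardinality is attained, and the empty set cannot span a nonempty \<open>X\<close>; this lower
  bound later keeps the logarithm nonnegative.\<close>

lemma spanning_number_bounds_of_labels:
  assumes "finite L" and "lab ` X \<subseteq> L"
    and "\<And>x y. x \<in> X \<Longrightarrow> y \<in> X \<Longrightarrow> lab x = lab y \<Longrightarrow> bowen_dist f n x y \<le> \<epsilon>"
    and "X \<noteq> {}"
  shows "1 \<le> spanning_number X f n \<epsilon>" and "spanning_number X f n \<epsilon> \<le> card L"
proof -
  let ?P = "\<lambda>k. \<exists>E. finite E \<and> E \<subseteq> X \<and> card E = k \<and> (\<forall>x\<in>X. \<exists>y\<in>E. bowen_dist f n x y \<le> \<epsilon>)"
  define E where "E = inv_into X lab ` lab ` X"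
  have fin: "finite (lab ` X)"
    using assms(1,2) finite_subset by blast
  have "finite E" "E \<subseteq> X"
    unfolding E_def using fin by (auto intro: inv_into_into)
  moreover have "\<exists>y\<in>E. bowen_dist f n x y \<le> \<epsilon>" if "x \<in> X" for x
  proof
    show "inv_into X lab (lab x) \<in> E" using that by (auto simp: E_def)
    show "bowen_dist f n x (inv_into X lab (lab x)) \<le> \<epsilon>"
      using that by (intro assms(3)) (auto simp: f_inv_into_f intro: inv_into_into)
  qed
  ultimately have P: "?P (card E)" by blast
  have "card E \<le> card L"
    unfolding E_def using card_image_le[OF fin] card_mono[OF assms(1,2)] by (meson order_trans)
  moreover have "spanning_number X f n \<epsilon> \<le> card E"
    unfolding spanning_number_def by (rule Least_le) (rule P)
  ultimately show "spanning_number X f n \<epsilon> \<le> card L" by linarith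
  have "?P (spanning_number X f n \<epsilon>)"
    unfolding spanning_number_def by (rule LeastI) (rule P)
  then obtain E' where E': "finite E'" "card E' = spanning_number X f n \<epsilon>"
    "\<forall>x\<in>X. \<exists>y\<in>E'. bowen_dist f n x y \<le> \<epsilon>"
    by blast
  then have "E' \<noteq> {}"
    using \<open>X \<noteq> {}\<close> by blast
  then show "1 \<le> spanning_number X f n \<epsilon>"
    using E'(1,2) card_gt_0_iff[of E'] by simp
qed

section \<open>Order structure of maps swapping two outer intervals\<close>

text \<open>Periods and entropy are derived from this shape alone; the freedom left in the outer
  branches serves later to prescribe an orbit. Monotonicity is weak, since the constructed branches
  may have plateaus.\<close>

locale swap_map =
  fixes f :: "real \<Rightarrow> real" and p q :: real
  assumes order: "0 \<le> p" "p < q" "q \<le> 1"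
    and cont: "continuous_on {0..1} f"
    and left_right: "f ` {0..p} \<subseteq> {q..1}"
    and right_left: "f ` {q..1} \<subseteq> {0..p}"
    and mono_left: "mono_on {0..p} f"
    and mono_right: "mono_on {q..1} f"
    and antimono_mid: "antimono_on {p..q} f"
begin

lemma maps_left: "x \<in> {0..p} \<Longrightarrow> f x \<in> {q..1}"
  and maps_right: "x \<in> {q..1} \<Longrightarrow> f x \<in> {0..p}"
  using left_right right_left by blast+

lemma maps_unit: "x \<in> {0..1} \<Longrightarrow> f x \<in> {0..1}"
proof -
  assume x: "x \<in> {0..1}"
  consider "x \<in> {0..p}" | "x \<in> {q..1}" | "x \<in> {p..q}"
    using x by fastforce
  then show ?thesis
  proof cases
    case 3
    then have "f x \<le> f p" "f q \<le> f x"
      using order antimono_mid by (auto simp: monotone_on_def)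
    moreover have "f p \<in> {q..1}" "f q \<in> {0..p}"
      using order by (intro maps_left maps_right; simp)+
    ultimately show ?thesis using order by auto
  qed (use maps_left maps_right order in force)+
qed

lemma iterate_unit: "x \<in> {0..1} \<Longrightarrow> (f ^^ i) x \<in> {0..1}"
proof (induction i)
  case (Suc i)
  then show ?case using maps_unit[of "(f ^^ i) x"] by simp
qed simp

lemma same_side_step:
  assumes "x \<in> {0..p} \<and> y \<in> {0..p} \<or> x \<in> {q..1} \<and> y \<in> {q..1}"
  shows "f x \<in> {0..p} \<and> f y \<in> {0..p} \<or> f x \<in> {q..1} \<and> f y \<in> {q..1}"
  using assms left_right right_left by blast

lemma same_side_mono:
  assumes "x \<in> {0..p} \<and> y \<in> {0..p} \<or> x \<in> {q..1} \<and> y \<in> {q..1}" "x \<le> y"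
  shows "f x \<le> f y"
  using assms mono_left mono_right by (auto simp: monotone_on_def)

text \<open>Each step from the middle reverses the order and each step after a common exit on one
  side keeps it, so the sign counts the \<open>min i j\<close> steps made from the middle. The value
  \<open>j = n\<close> covers pairs that stay in the middle at all times below
  \<open>n\<close>.\<close>

lemma iterates_monotone:
  assumes "x \<le> y" and "j \<le> n"
    and mid: "\<And>k. k < j \<Longrightarrow> (f ^^ k) x \<in> {p..q} \<and> (f ^^ k) y \<in> {p..q}"
    and out: "j < n \<Longrightarrow> (f ^^ j) x \<in> {0..p} \<and> (f ^^ j) y \<in> {0..p} \<or>
                (f ^^ j) x \<in> {q..1} \<and> (f ^^ j) y \<in> {q..1}"
    and "i < n"
  shows "(-1) ^ min i j * (f ^^ i) x \<le> (-1) ^ min i j * (f ^^ i) y"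
proof -
  have early: "(-1) ^ i * (f ^^ i) x \<le> (-1) ^ i * (f ^^ i) y" if "i \<le> j" for i
    using that
  proof (induction i)
    case (Suc i)
    then have "(f ^^ i) x \<in> {p..q}" "(f ^^ i) y \<in> {p..q}"
      and IH: "(-1) ^ i * (f ^^ i) x \<le> (-1) ^ i * (f ^^ i) y"
      using mid[of i] by auto
    then show ?case
      using antimono_mid by (cases "even i") (auto simp: monotone_on_def)
  qed (use \<open>x \<le> y\<close> in simp)
  \<comment> \<open>The side is carried along in the induction, because keeping the order at the
    next step requires both points in the same outer interval.\<close>
  have late: "(-1) ^ j * (f ^^ (j + d)) x \<le> (-1) ^ j * (f ^^ (j + d)) y \<and>
      ((f ^^ (j + d)) x \<in> {0..p} \<and> (f ^^ (j + d)) y \<in> {0..p} \<or>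
       (f ^^ (j + d)) x \<in> {q..1} \<and> (f ^^ (j + d)) y \<in> {q..1})" if "j < n" for d
  proof (induction d)
    case 0
    then show ?case using early[of j] out[OF that] by simp
  next
    case (Suc d)
    let ?x = "(f ^^ (j + d)) x" and ?y = "(f ^^ (j + d)) y"
    have side: "?x \<in> {0..p} \<and> ?y \<in> {0..p} \<or> ?x \<in> {q..1} \<and> ?y \<in> {q..1}"
      and le: "(-1) ^ j * ?x \<le> (-1) ^ j * ?y"
      using Suc.IH by blast+
    have "(-1) ^ j * f ?x \<le> (-1) ^ j * f ?y"
      using le same_side_mono[of ?x ?y] same_side_mono[of ?y ?x] side
      by (cases "even j") auto
    then show ?case using same_side_step[OF side] by simp
  qed
  show ?thesis
  proof (cases "i \<le> j")
    case True
    then show ?thesis using early[of i] by (simp add: min_def)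
  next
    case False
    then show ?thesis using late[of "i - j"] \<open>i < n\<close> by (simp add: min_def)
  qed
qed

lemma iterate_outside:
  assumes "(f ^^ k) x \<in> {0..p} \<union> {q..1}" "k \<le> n"
  shows "(f ^^ n) x \<in> {0..p} \<union> {q..1}"
  using assms(2)
proof (induction n rule: dec_induct)
  case base
  then show ?case by (fact assms(1))
next
  case (step n)
  then show ?case
    using left_right right_left unfolding funpow.simps comp_def by blast
qed

section \<open>Periods\<close>

text \<open>Even iterates preserve the order of \<open>x\<close> and \<open>f (f x)\<close>. Hence
  the points \<open>(f ^^ (2 * k)) x\<close> move monotonically up to \<open>k = r\<close>, where
  they are back at \<open>x\<close>, so they never move at all.\<close>

lemma periodic_imp_period_two:
  assumes x: "x \<in> {0..1}" and "0 < r" and per: "(f ^^ r) x = x"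
  shows "f (f x) = x"
proof -
  let ?y = "f (f x)"
  have shift: "(f ^^ k) ?y = (f ^^ (k + 2)) x" for k
    by (simp add: funpow_swap1 numeral_2_eq_2)
  have per': "(f ^^ (r * k)) x = x" for k
  proof (induction k)
    case (Suc k)
    then show ?case by (simp add: funpow_add per)
  qed simp
  \<comment> \<open>This exceeds every time \<open>2 * k\<close> with \<open>k <= r\<close>, so
    \<open>min (2 * k) j\<close> is even both for even \<open>j\<close> and for
    \<open>j = n\<close>. An orbit outside the middle will use \<open>j = 0\<close>, an orbit inside
    it \<open>j = n\<close>.\<close>
  define n where "n = 2 * r + 1"
  obtain j where j: "j \<le> n" "even j \<or> j = n"
    and mid: "\<And>k. k < j \<Longrightarrow> (f ^^ k) x \<in> {p..q} \<and> (f ^^ k) ?y \<in> {p..q}"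
    and out: "j < n \<Longrightarrow> (f ^^ j) x \<in> {0..p} \<and> (f ^^ j) ?y \<in> {0..p} \<or>
                (f ^^ j) x \<in> {q..1} \<and> (f ^^ j) ?y \<in> {q..1}"
  proof (cases "\<exists>k. (f ^^ k) x \<in> {0..p} \<union> {q..1}")
    case True
    then obtain k where "(f ^^ k) x \<in> {0..p} \<union> {q..1}" by blast
    \<comment> \<open>Once outside, the orbit stays outside; at time \<open>r * k\<close> it is back
      at \<open>x\<close>, so \<open>x\<close> itself is outside.\<close>
    moreover have "k \<le> r * k" using \<open>0 < r\<close> by simp
    ultimately have "(f ^^ (r * k)) x \<in> {0..p} \<union> {q..1}"
      by (rule iterate_outside)
    then have "x \<in> {0..p} \<union> {q..1}" by (simp only: per')
    then have "x \<in> {0..p} \<and> ?y \<in> {0..p} \<or> x \<in> {q..1} \<and> ?y \<in> {q..1}"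
      using left_right right_left by blast
    then show ?thesis using that[of 0] by simp
  next
    case False
    then have "(f ^^ k) x \<in> {p..q}" for k
      using iterate_unit[OF x, of k] by force
    then have "(f ^^ k) x \<in> {p..q} \<and> (f ^^ k) ?y \<in> {p..q}" for k
      by (simp only: shift)
    then show ?thesis using that[of n] by blast
  qed
  have even_le: "(f ^^ (2 * k)) u \<le> (f ^^ (2 * k)) v"
    if "u \<le> v" "k \<le> r" "{u, v} = {x, ?y}" for u v k
  proof -
    have "even (min (2 * k) j)"
      using j that by (auto simp: min_def n_def)
    moreover have "(-1) ^ min (2 * k) j * (f ^^ (2 * k)) u \<le> (-1) ^ min (2 * k) j * (f ^^ (2 * k)) v"
      using that j(1) mid out
      by (intro iterates_monotone[where n = n]) (auto simp: n_def doubleton_eq_iff)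
    ultimately show ?thesis by simp
  qed
  have shift2: "(f ^^ (2 * Suc (Suc k))) x = (f ^^ (2 * Suc k)) ?y" for k
    using shift[of "2 * Suc k"] by (metis add.commute mult_Suc_right)
  have per2: "(f ^^ (2 * r)) x = x" using per'[of 2] by (simp add: mult.commute)
  show ?thesis
  proof (cases "x \<le> ?y")
    case True
    have "?y \<le> (f ^^ (2 * Suc k)) x" if "k < r" for k
      using that
    proof (induction k)
      case (Suc k)
      have "(f ^^ (2 * Suc k)) x \<le> (f ^^ (2 * Suc k)) ?y"
        using Suc.prems True by (intro even_le) auto
      then show ?case using Suc.IH Suc.prems unfolding shift2 by linarith
    qed (simp add: numeral_2_eq_2)
    from this[of "r - 1"] show ?thesis using True per2 \<open>0 < r\<close> by simp
  next
    case False
    have "(f ^^ (2 * Suc k)) x \<le> ?y" if "k < r" for k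
      using that
    proof (induction k)
      case (Suc k)
      have "(f ^^ (2 * Suc k)) ?y \<le> (f ^^ (2 * Suc k)) x"
        using Suc.prems False by (intro even_le) auto
      then show ?case using Suc.IH Suc.prems unfolding shift2 by linarith
    qed (simp add: numeral_2_eq_2)
    from this[of "r - 1"] show ?thesis using False per2 \<open>0 < r\<close> by simp
  qed
qed

text \<open>Period 1 comes from a fixed point of \<open>f\<close>, period 2 from a fixed point of
  \<open>f \<circ> f\<close> in \<open>{0..p}\<close>, which \<open>f\<close> sends to the disjoint
  interval \<open>{q..1}\<close>.\<close>

lemma periods_eq: "periods {0..1} f = {1, 2}"
proof
  show "periods {0..1} f \<subseteq> {1, 2}"
  proof
    fix r assume "r \<in> periods {0..1} f"
    then obtain x where x: "x \<in> {0..1}" "least_period f x r"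
      by (auto simp: periods_def)
    then have "f (f x) = x"
      using periodic_imp_period_two by (auto simp: least_period_def)
    then have "\<not> 2 < r"
      using x(2) by (auto simp: least_period_def numeral_2_eq_2)
    then show "r \<in> {1, 2}"
      using x(2) by (auto simp: least_period_def)
  qed
  obtain c where "c \<in> {0..1}" "f c = c"
    using brouwer[of "{0..1}" f] cont maps_unit by (auto simp: Pi_iff)
  then have one: "1 \<in> periods {0..1} f"
    by (auto simp: periods_def least_period_def)
  have "continuous_on {0..p} (f \<circ> f)"
    using order maps_unit by (intro continuous_on_compose continuous_on_subset[OF cont]) auto
  moreover have "f \<circ> f \<in> {0..p} \<rightarrow> {0..p}"
    using left_right right_left unfolding Pi_iff comp_def by blast
  ultimately obtain d where d: "d \<in> {0..p}" "f (f d) = d"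
    using brouwer[of "{0..p}" "f \<circ> f"] order by auto
  then have "f d \<noteq> d"
    using maps_left[of d] order by force
  with d have "2 \<in> periods {0..1} f"
    using order by (auto simp: periods_def least_period_def numeral_2_eq_2 less_Suc_eq intro!: bexI[of _ d])
  with one show "{1, 2} \<subseteq> periods {0..1} f" by blast
qed

section \<open>Counting itineraries and zero entropy\<close>

text \<open>The cap \<open>n\<close> guarantees that the minimum exists. Leaving the open interval
  puts a point of the unit interval into a closed outer interval.\<close>

definition exit_time :: "nat \<Rightarrow> real \<Rightarrow> nat" where
  "exit_time n x = (LEAST k. k = n \<or> (f ^^ k) x \<notin> {p<..<q})"

text \<open>The floor is the index of a grid cell of width \<open>1 / N\<close>. The sign is that of
  \<open>iterates_monotone\<close>, so that each summand is monotone in \<open>x\<close> among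
  points sharing exit time and side.\<close>

definition itinerary_sum :: "nat \<Rightarrow> nat \<Rightarrow> real \<Rightarrow> int" where
  "itinerary_sum N n x = (\<Sum>i<n. (-1) ^ min i (exit_time n x) * \<lfloor>real N * (f ^^ i) x\<rfloor>)"

lemma exit_time_le: "exit_time n x \<le> n"
  unfolding exit_time_def by (rule Least_le) simp

lemma abs_itinerary_sum_le:
  assumes "x \<in> {0..1}"
  shows "\<bar>itinerary_sum N n x\<bar> \<le> int (n * N)"
proof -
  have "\<bar>(-1) ^ min i (exit_time n x) * \<lfloor>real N * (f ^^ i) x\<rfloor>\<bar> \<le> int N" for i
  proof -
    have "0 \<le> (f ^^ i) x" "(f ^^ i) x \<le> 1"
      using iterate_unit[OF assms, of i] by auto
    then have "0 \<le> real N * (f ^^ i) x" "real N * (f ^^ i) x \<le> real N"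
      by (auto simp: mult_left_le)
    then have "0 \<le> \<lfloor>real N * (f ^^ i) x\<rfloor>" "\<lfloor>real N * (f ^^ i) x\<rfloor> \<le> int N"
      by (auto simp: floor_le_iff)
    then show ?thesis by (simp add: abs_mult power_abs)
  qed
  then have "\<bar>itinerary_sum N n x\<bar> \<le> (\<Sum>i<n. int N)"
    unfolding itinerary_sum_def by (intro order_trans[OF sum_abs] sum_mono)
  then show ?thesis by simp
qed

text \<open>Points with equal exit time and exit side are ordered by all iterates, up to a sign which is
  common to all such points; hence equality of the sums forces equality of the summands.\<close>

lemma same_label_bowen:
  assumes xy: "x \<in> {0..1}" "y \<in> {0..1}" and "0 < n" "0 < N"
    and exit: "exit_time n x = exit_time n y"
    and side: "(f ^^ exit_time n x) x \<le> p \<longleftrightarrow> (f ^^ exit_time n x) y \<le> p"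
    and sum: "itinerary_sum N n x = itinerary_sum N n y"
  shows "bowen_dist f n x y \<le> 1 / real N"
proof -
  define j where "j = exit_time n x"
  have "j \<le> n" by (simp add: j_def exit_time_le)
  have mid: "(f ^^ k) z \<in> {p..q}" if "k < exit_time n z" for k z
    using not_less_Least[OF that[unfolded exit_time_def]] by auto
  have out: "(f ^^ exit_time n z) z \<notin> {p<..<q}" if "exit_time n z < n" for z
    using that LeastI[of "\<lambda>k. k = n \<or> (f ^^ k) z \<notin> {p<..<q}" n]
    unfolding exit_time_def by auto
  have mid_xy: "(f ^^ k) x \<in> {p..q}" "(f ^^ k) y \<in> {p..q}" if "k < j" for k
    using mid[of k x] mid[of k y] that exit by (auto simp: j_def)
  have out_xy: "(f ^^ j) x \<in> {0..p} \<and> (f ^^ j) y \<in> {0..p} \<or>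
      (f ^^ j) x \<in> {q..1} \<and> (f ^^ j) y \<in> {q..1}" if "j < n"
    using out[of x] out[of y] that exit side iterate_unit[OF xy(1), of j] iterate_unit[OF xy(2), of j]
    by (auto simp: j_def)
  have floors: "\<lfloor>real N * (f ^^ i) u\<rfloor> = \<lfloor>real N * (f ^^ i) v\<rfloor>"
    if "u \<le> v" "{u, v} = {x, y}" "i < n" for u v i
  proof -
    define F where "F z i = (-1) ^ min i j * \<lfloor>real N * (f ^^ i) z\<rfloor>" for z i
    have "F u i \<le> F v i" if "i < n" for i
    proof -
      have "(-1) ^ min i j * (f ^^ i) u \<le> (-1) ^ min i j * (f ^^ i) v"
        using \<open>u \<le> v\<close> \<open>{u, v} = {x, y}\<close> \<open>j \<le> n\<close> mid_xy out_xy that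
        by (intro iterates_monotone[where n = n]) (auto simp: doubleton_eq_iff)
      then show ?thesis
        using \<open>0 < N\<close> unfolding F_def by (cases "even (min i j)") (auto intro!: floor_mono)
    qed
    moreover have "sum (F u) {..<n} = sum (F v) {..<n}"
      using sum exit \<open>{u, v} = {x, y}\<close>
      by (auto simp: itinerary_sum_def F_def j_def doubleton_eq_iff)
    ultimately have "F u i = F v i"
      using \<open>i < n\<close> by (intro sum_mono_inv[of "F u" "{..<n}" "F v" i]) auto
    then have "\<lfloor>real N * (f ^^ i) u\<rfloor> = \<lfloor>real N * (f ^^ i) v\<rfloor>" by (cases "even (min i j)") (simp_all add: F_def)
    then show ?thesis by simp
  qed
  have "dist ((f ^^ i) x) ((f ^^ i) y) \<le> 1 / real N" if "i < n" for i
  proof -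
    have "\<lfloor>real N * (f ^^ i) x\<rfloor> = \<lfloor>real N * (f ^^ i) y\<rfloor>"
    proof (cases "x \<le> y")
      case True
      from floors[OF this refl that] show ?thesis .
    next
      case False
      then have "y \<le> x" by simp
      from floors[OF this insert_commute that] show ?thesis by (rule sym)
    qed
    then have "\<bar>real N * (f ^^ i) x - real N * (f ^^ i) y\<bar> \<le> 1"
      by linarith
    then have "real N * \<bar>(f ^^ i) x - (f ^^ i) y\<bar> \<le> 1"
      by (simp flip: right_diff_distrib add: abs_mult)
    then show ?thesis using \<open>0 < N\<close> by (simp add: dist_real_def field_simps)
  qed
  then show ?thesis
    using \<open>0 < n\<close> unfolding bowen_dist_def by (subst Max_le_iff) auto
qed

text \<open>The factors count the exit times up to \<open>n\<close>, the two sides, and the integers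
  of modulus at most \<open>n * N\<close>.\<close>

lemma spanning_number_bounds:
  assumes "0 < n" "0 < N" "1 / real N \<le> \<epsilon>"
  shows "1 \<le> spanning_number {0..1} f n \<epsilon>"
    and "spanning_number {0..1} f n \<epsilon> \<le> (n + 1) * (2 * (2 * (n * N) + 1))"
proof -
  define L where "L = {..n} \<times> (UNIV :: bool set) \<times> {- int (n * N) .. int (n * N)}"
  define lab where "lab x = (exit_time n x, (f ^^ exit_time n x) x \<le> p, itinerary_sum N n x)" for x
  have fin: "finite L" and card_L: "card L = (n + 1) * (2 * (2 * (n * N) + 1))"
    by (simp_all add: L_def card_cartesian_product nat_add_distrib nat_mult_distrib)
  have sub: "lab ` {0..1} \<subseteq> L"
    using abs_itinerary_sum_le[of _ N n] exit_time_le
    by (fastforce simp: lab_def L_def abs_le_iff)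
  have same: "bowen_dist f n x y \<le> \<epsilon>" if "x \<in> {0..1}" "y \<in> {0..1}" "lab x = lab y" for x y
    using same_label_bowen[of x y n N] that assms by (auto simp: lab_def)
  have ne: "{0..1::real} \<noteq> {}" by simp
  show "1 \<le> spanning_number {0..1} f n \<epsilon>"
    by (rule spanning_number_bounds_of_labels(1)[OF fin sub _ ne]) (rule same)
  show "spanning_number {0..1} f n \<epsilon> \<le> (n + 1) * (2 * (2 * (n * N) + 1))"
    unfolding card_L[symmetric]
    by (rule spanning_number_bounds_of_labels(2)[OF fin sub _ ne]) (rule same)
qed

text \<open>For fixed \<open>\<epsilon>\<close> the spanning numbers grow at most quadratically in
  \<open>n\<close>, so their logarithms divided by \<open>n\<close> tend to 0.\<close>

lemma top_entropy_eq_0: "top_entropy {0..1} f = 0"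
proof -
  have "limsup (\<lambda>n. ereal (ln (real (spanning_number {0..1} f n \<epsilon>)) / real n)) = 0"
    if pos: "\<epsilon> > 0" for \<epsilon> :: real
  proof -
    obtain M where M: "inverse (real (Suc M)) < \<epsilon>"
      using reals_Archimedean[OF pos] by blast
    define N where "N = Suc M"
    have N: "0 < N" "1 / real N \<le> \<epsilon>" using M by (auto simp: N_def inverse_eq_divide)
    have bounds: "0 \<le> ln (real (spanning_number {0..1} f n \<epsilon>)) / real n"
      "ln (real (spanning_number {0..1} f n \<epsilon>)) / real n
        \<le> ln (16 * real N) / real n + 2 * (ln (real n) / real n)" if "0 < n" for n
    proof -
      note b = spanning_number_bounds[OF that N]
      \<comment> \<open>The bounds \<open>n + 1 <= 2 * n\<close> and
        \<open>2 * (n * N) + 1 <= 4 * (n * N)\<close> produce the constant 16.\<close>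
      have "(n + 1) * (2 * (2 * (n * N) + 1)) \<le> (2 * n) * (2 * (4 * (n * N)))"
        using that N(1) by (intro mult_le_mono) auto
      with b(2) have "real (spanning_number {0..1} f n \<epsilon>) \<le> real ((2 * n) * (2 * (4 * (n * N))))"
        by (simp only: of_nat_le_iff)
      then have "real (spanning_number {0..1} f n \<epsilon>) \<le> 16 * real N * (real n * real n)"
        by (simp add: ac_simps)
      moreover have "0 < real (spanning_number {0..1} f n \<epsilon>)"
        using b(1) by linarith
      ultimately have "ln (real (spanning_number {0..1} f n \<epsilon>)) \<le> ln (16 * real N * (real n * real n))"
        by (rule ln_mono)
      also have "\<dots> = ln (16 * real N) + 2 * ln (real n)"
        using that N(1) by (simp add: ln_mult)
      finally have "ln (real (spanning_number {0..1} f n \<epsilon>)) / real n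
          \<le> (ln (16 * real N) + 2 * ln (real n)) / real n"
        by (rule divide_right_mono) simp
      then show "ln (real (spanning_number {0..1} f n \<epsilon>)) / real n
          \<le> ln (16 * real N) / real n + 2 * (ln (real n) / real n)"
        by (simp add: add_divide_distrib)
      show "0 \<le> ln (real (spanning_number {0..1} f n \<epsilon>)) / real n"
        using b(1) by simp
    qed
    have "(\<lambda>n. ln (16 * real N) / real n + 2 * (ln (real n) / real n)) \<longlonglongrightarrow> 0 + 2 * 0"
      by (intro tendsto_intros lim_const_over_n lim_ln_over_n)
    then have lim: "(\<lambda>n. ln (16 * real N) / real n + 2 * (ln (real n) / real n)) \<longlonglongrightarrow> 0"
      by simp
    have "\<forall>\<^sub>F n in sequentially. 0 \<le> ln (real (spanning_number {0..1} f n \<epsilon>)) / real n"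
      using eventually_gt_at_top[of 0] by (rule eventually_mono) (rule bounds(1))
    moreover have "\<forall>\<^sub>F n in sequentially. ln (real (spanning_number {0..1} f n \<epsilon>)) / real n
        \<le> ln (16 * real N) / real n + 2 * (ln (real n) / real n)"
      using eventually_gt_at_top[of 0] by (rule eventually_mono) (rule bounds(2))
    ultimately have "(\<lambda>n. ln (real (spanning_number {0..1} f n \<epsilon>)) / real n) \<longlonglongrightarrow> 0"
      by (rule tendsto_sandwich[OF _ _ tendsto_const lim])
    then show ?thesis
      by (intro lim_imp_Limsup) (auto simp: zero_ereal_def)
  qed
  then have "top_entropy {0..1} f = (SUP \<epsilon>\<in>{0::real<..}. (0::ereal))"
    unfolding top_entropy_def by (intro SUP_cong) auto
  then show ?thesis by simp
qed

end

section \<open>Monotone interpolation along decreasing sequences\<close>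

text \<open>\<open>h\<close> is a series of ramps: \<open>c k\<close> rises from 0 at
  \<open>s (Suc k)\<close> to 1 at \<open>s k\<close> and has weight \<open>t k - t (Suc k)\<close>.
  The weights sum to \<open>t 0\<close>, so convergence is uniform, which gives continuity also
  where the nodes accumulate.\<close>

lemma continuous_mono_interpolation:
  fixes s t :: "nat \<Rightarrow> real"
  assumes s: "\<And>k. s (Suc k) < s k" "\<And>k. 0 \<le> s k"
    and t: "decseq t" "t \<longlonglongrightarrow> 0"
  obtains h where "continuous_on UNIV h" "mono h" "\<And>k. h (s k) = t k"
    "\<And>x. x \<le> 0 \<Longrightarrow> h x = 0" "\<And>x. s 0 \<le> x \<Longrightarrow> h x = t 0"
proof -
  define c where "c k x = max 0 (min 1 ((x - s (Suc k)) / (s k - s (Suc k))))" for k x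
  define a where "a k = t k - t (Suc k)" for k
  define h where "h x = (\<Sum>k. a k * c k x)" for x
  have dec: "s m \<le> s k" if "k \<le> m" for k m
    using lift_Suc_antimono_le[of s] s(1) that by (simp add: less_imp_le)
  have c: "0 \<le> c k x" "c k x \<le> 1" for k x
    by (auto simp: c_def)
  have a: "0 \<le> a k" for k
    using t(1) by (simp add: a_def decseq_Suc_iff)
  have a_sums: "a sums t 0"
    using telescope_sums'[OF t(2)] by (simp add: a_def[abs_def])
  have bound: "norm (a k * c k x) \<le> a k" for k x
    using a c by (simp add: abs_mult mult_left_le)
  have summ: "summable (\<lambda>k. a k * c k x)" for x
    using bound sums_summable[OF a_sums] by (rule summable_comparison_test'[where N = 0, rotated])
  have one: "c k x = 1" if "s k \<le> x" for k x
    using that s(1)[of k] by (simp add: c_def)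
  have zero: "c k x = 0" if "x \<le> s (Suc k)" for k x
  proof -
    have "(x - s (Suc k)) / (s k - s (Suc k)) \<le> 0"
      using that s(1)[of k] by (simp add: divide_le_0_iff)
    then show ?thesis by (simp add: c_def)
  qed
  have "continuous_on UNIV h"
  proof (rule uniform_limit_theorem)
    show "uniform_limit UNIV (\<lambda>n x. \<Sum>k<n. a k * c k x) h sequentially"
      unfolding h_def using bound sums_summable[OF a_sums] by (intro Weierstrass_m_test) auto
    have "s k - s (Suc k) \<noteq> 0" for k using s(1)[of k] by simp
    then show "\<forall>\<^sub>F n in sequentially. continuous_on UNIV (\<lambda>x. \<Sum>k<n. a k * c k x)"
      unfolding c_def by (intro always_eventually allI continuous_intros) auto
  qed simp
  moreover have "mono h"
  proof (rule monoI)
    fix x y :: real assume "x \<le> y"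
    then have "c k x \<le> c k y" for k
      using s(1)[of k] unfolding c_def
      by (intro max.mono min.mono divide_right_mono order_refl) auto
    then show "h x \<le> h y"
      unfolding h_def using a by (intro suminf_le summ mult_left_mono) auto
  qed
  moreover have "h (s k) = t k" for k
  proof -
    \<comment> \<open>At \<open>s k\<close> the ramps with index at least \<open>k\<close> equal 1
      and the earlier ones vanish; with \<open>max\<close> both cases fit one telescoping
      series.\<close>
    have "a j * c j (s k) = t (max j k) - t (max (Suc j) k)" for j
    proof (cases "k \<le> j")
      case True
      then show ?thesis using one[OF dec[OF True]] by (simp add: a_def max_def)
    next
      case False
      then show ?thesis using zero[of "s k" j] dec[of "Suc j" k] by (simp add: max_def)
    qed
    moreover have "(\<lambda>j. t (max j k)) \<longlonglongrightarrow> 0"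
      by (rule Lim_transform_eventually[OF t(2)])
        (auto intro!: eventually_mono[OF eventually_ge_at_top[of k]] simp: max_def)
    from telescope_sums'[OF this] have "(\<lambda>j. t (max j k) - t (max (Suc j) k)) sums t k"
      by simp
    ultimately show ?thesis
      by (simp add: h_def sums_iff)
  qed
  moreover have "h x = 0" if "x \<le> 0" for x
    using zero[OF order_trans[OF that s(2)]] by (simp add: h_def)
  moreover have "h x = t 0" if "s 0 \<le> x" for x
    using one[OF order_trans[OF dec that]] sums_unique[OF a_sums] by (simp add: h_def)
  ultimately show thesis using that by blast
qed

section \<open>Correlation sums near a two-cycle\<close>

text \<open>Times of equal parity always give distance at most \<open>c\<close>. Mixed parities give
  \<open>c + t l - s k\<close>, which is too large exactly when \<open>s k < t l\<close>; each such
  \<open>(k, l)\<close> spoils two of the \<open>4 * n^2\<close> ordered pairs.\<close>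

lemma corr_sum_near_two_cycle:
  fixes f :: "real \<Rightarrow> real" and s t :: "nat \<Rightarrow> real"
  assumes "\<And>k. (f ^^ (2 * k)) x = a + s k" "\<And>k. (f ^^ (2 * k + 1)) x = a + c + t k"
    and "\<And>k. 0 \<le> s k \<and> s k \<le> c" "\<And>k. 0 \<le> t k \<and> t k \<le> c" and "0 < n"
  shows "corr_sum f 1 x (2 * n) c =
    1 - real (card {(k, l). k < n \<and> l < n \<and> s k < t l}) / (2 * (real n)\<^sup>2)"
proof -
  let ?D = "{(k, l). k < n \<and> l < n \<and> s k < t l}"
  let ?G = "{(i, j). i < 2 * n \<and> j < 2 * n \<and> dist ((f ^^ i) x) ((f ^^ j) x) \<le> c}"
  let ?g = "\<lambda>(k, l). (2 * k, 2 * l + 1) :: nat \<times> nat"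
  let ?h = "\<lambda>(k, l). (2 * l + 1, 2 * k) :: nat \<times> nat"
  have fin: "finite ?D"
    by (rule finite_subset[of _ "{..<n} \<times> {..<n}"]) auto
  have even_even: "dist ((f ^^ (2 * k)) x) ((f ^^ (2 * l)) x) \<le> c" for k l
    using assms(3)[of k] assms(3)[of l] unfolding assms(1,2) dist_real_def by linarith
  have odd_odd: "dist ((f ^^ (2 * k + 1)) x) ((f ^^ (2 * l + 1)) x) \<le> c" for k l
    using assms(4)[of k] assms(4)[of l] unfolding assms(1,2) dist_real_def by linarith
  have even_odd: "dist ((f ^^ (2 * k)) x) ((f ^^ (2 * l + 1)) x) \<le> c \<longleftrightarrow> t l \<le> s k" for k l
    using assms(3)[of k] assms(4)[of l] unfolding assms(1,2) dist_real_def by linarith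
  have odd_even: "dist ((f ^^ (2 * l + 1)) x) ((f ^^ (2 * k)) x) \<le> c \<longleftrightarrow> t l \<le> s k" for k l
    using even_odd by (simp add: dist_commute)
  have compl: "?G = {..<2 * n} \<times> {..<2 * n} - (?g ` ?D \<union> ?h ` ?D)" (is "_ = ?R")
  proof -
    have "(i, j) \<in> ?G \<longleftrightarrow> (i, j) \<in> ?R" for i j
    proof -
      consider k l where "i = 2 * k" "j = 2 * l" | k l where "i = 2 * k + 1" "j = 2 * l + 1"
        | k l where "i = 2 * k" "j = 2 * l + 1" | k l where "i = 2 * l + 1" "j = 2 * k"
        by (metis oddE evenE)
      then show ?thesis
      proof cases
        case 1
        have "(i, j) \<notin> ?g ` ?D \<union> ?h ` ?D" unfolding 1 by (auto; presburger)
        then show ?thesis using even_even[of k l] unfolding 1 by auto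
      next
        case 2
        have "(i, j) \<notin> ?g ` ?D \<union> ?h ` ?D" unfolding 2 by (auto; presburger)
        then show ?thesis using odd_odd[of k l] unfolding 2 by auto
      next
        case 3
        have "(i, j) \<in> ?g ` ?D \<union> ?h ` ?D \<longleftrightarrow> (k, l) \<in> ?D"
          unfolding 3 by (auto simp: image_iff; presburger)
        then show ?thesis using even_odd[of k l] unfolding 3 by auto
      next
        case 4
        have "(i, j) \<in> ?g ` ?D \<union> ?h ` ?D \<longleftrightarrow> (k, l) \<in> ?D"
          unfolding 4 by (auto simp: image_iff; presburger)
        then show ?thesis using odd_even[of l k] unfolding 4 by auto
      qed
    qed
    then show ?thesis unfolding set_eq_iff split_paired_All by blast
  qed
  have "card (?g ` ?D \<union> ?h ` ?D) = card (?g ` ?D) + card (?h ` ?D)"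
  proof (rule card_Un_disjoint[OF finite_imageI[OF fin] finite_imageI[OF fin]])
    have "even (fst z)" if "z \<in> ?g ` ?D" for z using that by auto
    moreover have "odd (fst z)" if "z \<in> ?h ` ?D" for z using that by auto
    ultimately show "?g ` ?D \<inter> ?h ` ?D = {}" by blast
  qed
  also have "\<dots> = 2 * card ?D"
    by (subst (1 2) card_image) (auto simp: inj_on_def)
  finally have bad: "card (?g ` ?D \<union> ?h ` ?D) = 2 * card ?D" .
  have sub: "?g ` ?D \<union> ?h ` ?D \<subseteq> {..<2 * n} \<times> {..<2 * n}"
    by auto
  \<comment> \<open>This makes the subtraction of naturals below agree with that of reals.\<close>
  have le: "2 * card ?D \<le> (2 * n) * (2 * n)"
    using card_mono[OF _ sub] unfolding bad card_cartesian_product by simp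
  have "card ?G = (2 * n) * (2 * n) - 2 * card ?D"
    unfolding compl using fin by (subst card_Diff_subset[OF _ sub]) (simp_all only: bad
      card_cartesian_product finite_Un finite_imageI card_lessThan simp_thms)
  then have "real (card ?G) = 4 * (real n)\<^sup>2 - 2 * real (card ?D)"
    using le by (simp add: of_nat_diff power2_eq_square)
  moreover have "corr_sum f 1 x (2 * n) c = real (card ?G) / (4 * (real n)\<^sup>2)"
    by (simp add: corr_sum_def bowen_dist_def lessThan_Suc power2_eq_square flip: funpow_simps_right)
  ultimately show ?thesis
    using \<open>0 < n\<close> by (simp add: field_simps)
qed

section \<open>Keys interleaved in geometric blocks\<close>

text \<open>The keys are arranged so that, in increasing order, the even and the odd ones alternate in blocks
  whose lengths grow geometrically: \<open>even_key k\<close> with \<open>3 * 9 ^ j \<le> k < 3 * 9 ^ (j + 1)\<close> lie between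
  \<open>odd_key l\<close> with \<open>9 ^ j \<le> l < 9 ^ (j + 1)\<close> and those with \<open>9 ^ (j + 1) \<le> l < 9 ^ (j + 2)\<close>.
  The fractional term only makes the keys strictly increasing.\<close>

definition even_key :: "nat \<Rightarrow> real" where
  "even_key k = 3 + 2 * real (floorlog 9 (3 * k)) + real k / (real k + 1)"

definition odd_key :: "nat \<Rightarrow> real" where
  "odd_key k = 4 + 2 * real (floorlog 9 k) + real k / (real k + 1)"

lemma frac_bounds: "0 \<le> real k / (real k + 1)" "real k / (real k + 1) < 1"
  by auto

lemma frac_less: "real k / (real k + 1) < real (Suc k) / (real (Suc k) + 1)"
  by (simp add: field_simps)

lemma key_ge_3: "3 \<le> even_key k" "3 \<le> odd_key k"
  using frac_bounds[of k] unfolding even_key_def odd_key_def by linarith+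

lemma even_key_Suc: "even_key k < even_key (Suc k)"
proof -
  have "3 * k \<le> 3 * Suc k" by simp
  from floorlog_mono[OF this] show ?thesis
    unfolding even_key_def by (intro add_le_less_mono frac_less) simp
qed

lemma odd_key_Suc: "odd_key k < odd_key (Suc k)"
proof -
  have "floorlog 9 k \<le> floorlog 9 (Suc k)"
    by (rule floorlog_mono[OF le_SucI[OF le_refl]])
  then show ?thesis
    unfolding odd_key_def by (intro add_le_less_mono frac_less) simp
qed

text \<open>With \<open>F = floorlog 9 (3 * k)\<close> and \<open>G = floorlog 9 l\<close>, the even
  key lies in \<open>[3 + 2 F, 4 + 2 F)\<close> and the odd one in
  \<open>[4 + 2 G, 5 + 2 G)\<close>. These intervals are disjoint, so \<open>F\<close> and
  \<open>G\<close> decide.\<close>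

lemma odd_less_even_key_iff: "odd_key l < even_key k \<longleftrightarrow> floorlog 9 l < floorlog 9 (3 * k)"
proof
  assume "odd_key l < even_key k"
  then have "real (floorlog 9 l) < real (floorlog 9 (3 * k))"
    using frac_bounds[of k] frac_bounds[of l] unfolding even_key_def odd_key_def by linarith
  then show "floorlog 9 l < floorlog 9 (3 * k)" by simp
next
  assume "floorlog 9 l < floorlog 9 (3 * k)"
  then have "real (floorlog 9 l) + 1 \<le> real (floorlog 9 (3 * k))" by linarith
  then show "odd_key l < even_key k"
    using frac_bounds[of k] frac_bounds[of l] unfolding even_key_def odd_key_def by linarith
qed

lemma filterlim_floorlog:
  assumes "1 < b"
  shows "filterlim (floorlog b) at_top sequentially"
  unfolding filterlim_at_top
proof
  fix Z
  show "\<forall>\<^sub>F n in sequentially. Z \<le> floorlog b n"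
    using assms
    by (intro eventually_mono[OF eventually_ge_at_top[of "b ^ (Z - 1)"]]) (auto intro: floorlog_geI)
qed

lemma keys_at_top:
  "filterlim even_key at_top sequentially" "filterlim odd_key at_top sequentially"
proof -
  have lim: "filterlim (\<lambda>n. real (floorlog 9 n)) at_top sequentially"
    by (rule filterlim_compose[OF filterlim_real_sequentially filterlim_floorlog]) simp
  have "real (floorlog 9 k) \<le> even_key k" for k
  proof -
    have "floorlog 9 k \<le> floorlog 9 (3 * k)" by (intro floorlog_mono) simp
    then show ?thesis using frac_bounds[of k] unfolding even_key_def by linarith
  qed
  then show "filterlim even_key at_top sequentially"
    by (intro filterlim_at_top_mono[OF lim]) auto
  have "real (floorlog 9 k) \<le> odd_key k" for k
    using frac_bounds[of k] unfolding odd_key_def by linarith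
  then show "filterlim odd_key at_top sequentially"
    by (intro filterlim_at_top_mono[OF lim]) auto
qed

text \<open>The cutoff ends an even block: the largest admissible even keys exceed only the odd keys
  with \<open>l < 9 ^ j\<close>. So at most one third of all pairs count.\<close>

lemma card_odd_less_even_key_le:
  "card {(k, l). k < 3 * 9 ^ j \<and> l < 3 * 9 ^ j \<and> odd_key l < even_key k} \<le> 3 * 9 ^ j * 9 ^ j"
proof -
  have "l < 9 ^ j" if "k < 3 * 9 ^ j" "odd_key l < even_key k" for k l
  proof (rule ccontr)
    assume "\<not> l < 9 ^ j"
    then have "Suc j \<le> floorlog 9 l" by (intro floorlog_ge_SucI) auto
    moreover have "floorlog 9 (3 * k) \<le> Suc j" using that(1) by (intro floorlog_leI) auto
    ultimately show False using that(2) by (simp add: odd_less_even_key_iff)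
  qed
  then have "{(k, l). k < 3 * 9 ^ j \<and> l < 3 * 9 ^ j \<and> odd_key l < even_key k}
      \<subseteq> {..<3 * 9 ^ j} \<times> {..<9 ^ j}"
    by auto
  from card_mono[OF _ this] show ?thesis
    by (simp add: card_cartesian_product)
qed

text \<open>The cutoff ends an odd block: each \<open>k\<close> from \<open>3 * 9 ^ j\<close> on,
  two thirds of the range, beats every admissible \<open>l\<close>. So at least two thirds of all
  pairs count.\<close>

lemma card_odd_less_even_key_ge:
  "6 * (3 * 9 ^ j) * (3 * 9 ^ j)
    \<le> card {(k, l). k < 9 ^ Suc j \<and> l < 9 ^ Suc j \<and> odd_key l < even_key k}" (is "_ \<le> card ?D")
proof -
  have "odd_key l < even_key k" if "3 * 9 ^ j \<le> k" "l < 9 ^ Suc j" for k l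
  proof -
    have "floorlog 9 l \<le> Suc j" using that(2) by (intro floorlog_leI) auto
    moreover have "Suc (Suc j) \<le> floorlog 9 (3 * k)" using that(1) by (intro floorlog_ge_SucI) auto
    ultimately show ?thesis by (simp add: odd_less_even_key_iff)
  qed
  then have "{3 * 9 ^ j..<9 ^ Suc j} \<times> {..<9 ^ Suc j} \<subseteq> ?D"
    by auto
  moreover have "finite ?D"
    by (rule finite_subset[of _ "{..<9 ^ Suc j} \<times> {..<9 ^ Suc j}"]) auto
  ultimately have "card ({3 * 9 ^ j..<9 ^ Suc j :: nat} \<times> {..<9 ^ Suc j :: nat}) \<le> card ?D"
    by (intro card_mono)
  then show ?thesis
    by (simp add: card_cartesian_product)
qed

section \<open>A swapping map with a prescribed orbit\<close>

lemma swap_map_with_orbit: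
  fixes s t :: "nat \<Rightarrow> real"
  assumes s: "\<And>k. s (Suc k) < s k" "\<And>k. 0 \<le> s k" "s 0 \<le> 1 / 3" "s \<longlonglongrightarrow> 0"
    and t: "\<And>k. t (Suc k) < t k" "\<And>k. 0 \<le> t k" "t 0 \<le> 1 / 3" "t \<longlonglongrightarrow> 0"
  obtains f where "swap_map f (1 / 3) (2 / 3)"
    "\<And>k. f (s k) = 2 / 3 + t k" "\<And>k. f (2 / 3 + t k) = s (Suc k)"
proof -
  have "decseq t" using t(1) by (simp add: decseq_Suc_iff less_imp_le)
  from continuous_mono_interpolation[of s t, OF s(1,2) this t(4)]
  obtain u where u: "continuous_on UNIV u" "mono u" "\<And>k. u (s k) = t k"
    "\<And>x. x \<le> 0 \<Longrightarrow> u x = 0" "\<And>x. s 0 \<le> x \<Longrightarrow> u x = t 0" by blast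
  have "decseq (\<lambda>k. s (Suc k))" using s(1) by (simp add: decseq_Suc_iff less_imp_le)
  \<comment> \<open>The index shift reflects that the orbit passes from \<open>2 / 3 + t k\<close>
    to the next term of \<open>s\<close>.\<close>
  from continuous_mono_interpolation[of t "\<lambda>k. s (Suc k)", OF t(1,2) this LIMSEQ_Suc[OF s(4)]]
  obtain v where v: "continuous_on UNIV v" "mono v" "\<And>k. v (t k) = s (Suc k)"
    "\<And>x. x \<le> 0 \<Longrightarrow> v x = 0" "\<And>x. t 0 \<le> x \<Longrightarrow> v x = s (Suc 0)" by blast
  define w where "w x = (2 / 3 + t 0) * max 0 (min 1 (3 * x - 1))" for x :: real
  \<comment> \<open>A single formula replaces gluing: \<open>u\<close> is constant from
    \<open>1 / 3\<close> on, \<open>v (x - 2 / 3)\<close> vanishes up to \<open>2 / 3\<close>, and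
    the ramp \<open>w\<close> in between reaches \<open>2 / 3 + t 0\<close>, cancelling the first
    two terms on the right.\<close>
  define f where "f x = 2 / 3 + u x - w x + v (x - 2 / 3)" for x
  have u_range: "0 \<le> u x" "u x \<le> 1 / 3" for x
    using monoD[OF u(2), of "min 0 x" x] monoD[OF u(2), of x "max (s 0) x"] u(4)[of "min 0 x"]
      u(5)[of "max (s 0) x"] t(3) by auto
  have v_range: "0 \<le> v x" "v x \<le> 1 / 3" for x
    using monoD[OF v(2), of "min 0 x" x] monoD[OF v(2), of x "max (t 0) x"] v(4)[of "min 0 x"]
      v(5)[of "max (t 0) x"] s(1)[of 0] s(3) by auto
  have left: "f x = 2 / 3 + u x" if "x \<le> 1 / 3" for x
    using that by (simp add: f_def w_def v(4))
  have right: "f x = v (x - 2 / 3)" if "2 / 3 \<le> x" for x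
    using that s(3) by (simp add: f_def w_def u(5) max_def min_def)
  have mid: "f x = 2 / 3 + t 0 - (2 / 3 + t 0) * (3 * x - 1)" if "1 / 3 \<le> x" "x \<le> 2 / 3" for x
    using that s(3) by (simp add: f_def w_def u(5) v(4) max_def min_def)
  have "swap_map f (1 / 3) (2 / 3)"
  proof
    have "continuous_on UNIV (\<lambda>x. v (x - 2 / 3))"
      by (rule continuous_on_compose2[OF v(1)]) (auto intro: continuous_intros)
    then have "continuous_on UNIV f"
      unfolding f_def w_def by (intro continuous_intros u(1)) auto
    then show "continuous_on {0..1} f"
      by (rule continuous_on_subset) simp
    have "2 / 3 + u x \<le> 1" for x
      using u_range(2)[of x] by linarith
    then show "f ` {0..1 / 3} \<subseteq> {2 / 3..1}"
      using u_range(1) by (auto simp: left)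
    show "f ` {2 / 3..1} \<subseteq> {0..1 / 3}"
      using v_range by (auto simp: right)
    show "mono_on {0..1 / 3} f"
      using monoD[OF u(2)] by (auto simp: monotone_on_def left)
    show "mono_on {2 / 3..1} f"
      using monoD[OF v(2)] by (auto simp: monotone_on_def right)
    show "antimono_on {1 / 3..2 / 3} f"
      using t(2)[of 0] by (auto simp: monotone_on_def mid intro!: mult_left_mono)
  qed auto
  moreover have "s k \<le> 1 / 3" for k
    using lift_Suc_antimono_le[of s 0 k] s(1,3) by (force simp: less_imp_le)
  then have "f (s k) = 2 / 3 + t k" for k
    by (simp add: left u(3))
  moreover have "f (2 / 3 + t k) = s (Suc k)" for k
    using right[of "2 / 3 + t k"] t(2)[of k] v(3)[of k] by simp
  ultimately show thesis using that by blast
qed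

section \<open>Limit points and oscillation\<close>

lemma omega_limit_two_cycle:
  fixes f :: "real \<Rightarrow> real"
  assumes even: "(\<lambda>k. (f ^^ (2 * k)) x) \<longlonglongrightarrow> a"
    and odd: "(\<lambda>k. (f ^^ (2 * k + 1)) x) \<longlonglongrightarrow> b"
  shows "omega_limit f x \<subseteq> {a, b}"
proof
  fix y assume "y \<in> omega_limit f x"
  then obtain r where r: "strict_mono r" and lim: "(\<lambda>k. (f ^^ r k) x) \<longlonglongrightarrow> y"
    by (auto simp: omega_limit_def)
  \<comment> \<open>The product tends to 0 along even and along odd times, hence along all times;
    this avoids a case split on the parities of \<open>r k\<close>.\<close>
  define z where "z n = ((f ^^ n) x - a) * ((f ^^ n) x - b)" for n
  have "(\<lambda>k. z (2 * k)) \<longlonglongrightarrow> (a - a) * (a - b)"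
    unfolding z_def by (intro tendsto_intros even)
  moreover have "(\<lambda>k. z (2 * k + 1)) \<longlonglongrightarrow> (b - a) * (b - b)"
    unfolding z_def by (intro tendsto_intros odd)
  ultimately have "z \<longlonglongrightarrow> 0"
    using limseq_even_odd[of z 0] by simp
  then have "(z \<circ> r) \<longlonglongrightarrow> 0"
    by (rule LIMSEQ_subseq_LIMSEQ) (rule r)
  moreover have "(z \<circ> r) \<longlonglongrightarrow> (y - a) * (y - b)"
    unfolding z_def comp_def by (intro tendsto_intros lim)
  ultimately have "(y - a) * (y - b) = 0"
    using LIMSEQ_unique by blast
  then show "y \<in> {a, b}" by auto
qed

lemma liminf_less_limsup_subseq:
  fixes X :: "nat \<Rightarrow> real" and r r' :: "nat \<Rightarrow> nat"
  assumes "strict_mono r" "\<And>n. X (r n) \<le> a"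
    and "strict_mono r'" "\<And>n. b \<le> X (r' n)"
    and "a < b"
  shows "liminf (\<lambda>n. ereal (X n)) < limsup (\<lambda>n. ereal (X n))"
proof -
  let ?X = "\<lambda>n. ereal (X n)"
  have "liminf ?X \<le> liminf (?X \<circ> r)"
    using assms(1) by (rule liminf_subseq_mono)
  also have "\<dots> \<le> ereal a"
    by (intro Liminf_le) (auto simp: assms(2))
  also have "\<dots> < ereal b"
    using \<open>a < b\<close> by simp
  also have "\<dots> \<le> limsup (?X \<circ> r')"
    by (intro le_Limsup) (auto simp: assms(4))
  also have "\<dots> \<le> limsup ?X"
    using assms(3) by (rule limsup_subseq_mono)
  finally show ?thesis .
qed

section \<open>The orbit with oscillating correlation sums\<close>

theorem proposition10:
  "\<exists>(f :: real \<Rightarrow> real) (x\<^sub>0 :: real) (m :: nat) (\<epsilon> :: real).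
     continuous_on {0..1} f \<and> f ` {0..1} \<subseteq> {0..1} \<and>
     top_entropy {0..1} f = 0 \<and> periods {0..1} f = {1, 2} \<and>
     x\<^sub>0 \<in> {0..1} \<and> finite (omega_limit f x\<^sub>0) \<and>
     m \<ge> 1 \<and> \<epsilon> > 0 \<and>
     lower_corr f m x\<^sub>0 \<epsilon> < upper_corr f m x\<^sub>0 \<epsilon>"
proof -
  \<comment> \<open>Reciprocals turn keys increasing to infinity into sequences decreasing to 0;
    keys of at least 3 keep them below or at \<open>1 / 3\<close>.\<close>
  define s where "s k = 1 / even_key k" for k
  define t where "t k = 1 / odd_key k" for k
  have pos: "0 < even_key k" "0 < odd_key k" for k
    using key_ge_3[of k] by linarith+
  have s: "s (Suc k) < s k" "0 \<le> s k" "s k \<le> 1 / 3" for k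
    using even_key_Suc[of k] key_ge_3[of k] pos[of k] pos[of "Suc k"]
    by (auto simp: s_def field_simps)
  have t: "t (Suc k) < t k" "0 \<le> t k" "t k \<le> 1 / 3" for k
    using odd_key_Suc[of k] key_ge_3[of k] pos[of k] pos[of "Suc k"]
    by (auto simp: t_def field_simps)
  have lim: "s \<longlonglongrightarrow> 0" "t \<longlonglongrightarrow> 0"
    unfolding s_def t_def
    by (intro tendsto_divide_0[OF tendsto_const] filterlim_at_top_imp_at_infinity keys_at_top)+
  have less_iff: "s k < t l \<longleftrightarrow> odd_key l < even_key k" for k l
    using pos by (simp add: s_def t_def field_simps)
  obtain f where swap: "swap_map f (1 / 3) (2 / 3)"
    and f: "\<And>k. f (s k) = 2 / 3 + t k" "\<And>k. f (2 / 3 + t k) = s (Suc k)"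
    using swap_map_with_orbit[of s t] s t lim by blast
  have even: "(f ^^ (2 * k)) (s 0) = s k" for k
    by (induction k) (simp_all add: f)
  then have odd: "(f ^^ (2 * k + 1)) (s 0) = 2 / 3 + t k" for k
    by (simp add: f)
  have "omega_limit f (s 0) \<subseteq> {0, 2 / 3 + 0}"
    by (intro omega_limit_two_cycle; unfold even odd; intro tendsto_intros lim)
  then have omega: "finite (omega_limit f (s 0))"
    by (rule finite_subset) simp
  define D where "D n = {(k, l). k < n \<and> l < n \<and> odd_key l < even_key k}" for n
  have corr: "corr_sum f 1 (s 0) (2 * n) (2 / 3) = 1 - real (card (D n)) / (2 * (real n)\<^sup>2)"
    if "0 < n" for n
    unfolding D_def less_iff[symmetric]
    using even odd s(2) t(2) that order_trans[OF s(3), of "2 / 3"] order_trans[OF t(3), of "2 / 3"]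
    by (intro corr_sum_near_two_cycle[where a = 0]) auto
  \<comment> \<open>At least two thirds of the pairs are in \<open>D\<close>, and
    \<open>1 - (2/3) / 2 = 2/3\<close>.\<close>
  have low: "corr_sum f 1 (s 0) (2 * 9 ^ Suc j) (2 / 3) \<le> 2 / 3" for j
  proof -
    have "6 * (3 * 9 ^ j) * (3 * 9 ^ j) \<le> card (D (9 ^ Suc j))"
      unfolding D_def by (rule card_odd_less_even_key_ge)
    then have "real (6 * (3 * 9 ^ j) * (3 * 9 ^ j)) \<le> real (card (D (9 ^ Suc j)))"
      by (simp only: of_nat_le_iff)
    then have "54 * (9 ^ j)\<^sup>2 \<le> real (card (D (9 ^ Suc j)))"
      by (simp add: power2_eq_square)
    then show ?thesis
      by (subst corr) (simp_all add: field_simps power_mult_distrib)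
  qed
  \<comment> \<open>At most one third of the pairs are in \<open>D\<close>, and
    \<open>1 - (1/3) / 2 = 5/6\<close>.\<close>
  have high: "5 / 6 \<le> corr_sum f 1 (s 0) (2 * (3 * 9 ^ j)) (2 / 3)" for j
  proof -
    have "card (D (3 * 9 ^ j)) \<le> 3 * 9 ^ j * 9 ^ j"
      unfolding D_def by (rule card_odd_less_even_key_le)
    then have "real (card (D (3 * 9 ^ j))) \<le> real (3 * 9 ^ j * 9 ^ j)"
      by (simp only: of_nat_le_iff)
    then have "real (card (D (3 * 9 ^ j))) \<le> 3 * (9 ^ j)\<^sup>2"
      by (simp add: power2_eq_square)
    then show ?thesis
      by (subst corr) (simp_all add: field_simps power_mult_distrib)
  qed
  have "lower_corr f 1 (s 0) (2 / 3) < upper_corr f 1 (s 0) (2 / 3)"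
    unfolding lower_corr_def upper_corr_def
    by (rule liminf_less_limsup_subseq[where r = "\<lambda>j. 2 * 9 ^ Suc j" and r' = "\<lambda>j. 2 * (3 * 9 ^ j)",
          OF _ low _ high]) (auto simp: strict_mono_Suc_iff)
  moreover have "continuous_on {0..1} f" "f ` {0..1} \<subseteq> {0..1}"
    using swap_map.cont[OF swap] swap_map.maps_unit[OF swap] by blast+
  moreover have "s 0 \<in> {0..1}"
    using s(2,3)[of 0] by simp
  ultimately show ?thesis
    using swap_map.top_entropy_eq_0[OF swap] swap_map.periods_eq[OF swap] omega
    by (intro exI[of _ f] exI[of _ "s 0"] exI[of _ 1] exI[of _ "2 / 3"]) simp
qed

end
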